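(* Let $\zeta\in\mathbb{R}$ with $\zeta\notin(a,b)$ and let $\tau,\sigma$ be constants. The only sequence $(P_n)_{n\ge0}$ which is an orthogonal polynomial sequence (OPS) for $\mathcal{L}_{(y-\zeta)\omega}$ and which is a solution of the nonlinear integral equation $$\int_a^b P_n(y)\,P_n\left[(y-\zeta)(\tau+\sigma x)+x\right]\omega(y)\,dy=P_n(x)$$ (for all $n\ge0$, as an identity in $x$) is $$P_n(x)=K_n(x;\zeta),\qquad n=0,1,\ldots,$$ where $K_n(x;\zeta)$ are the kernel polynomials corresponding to $\mathcal{L}_\omega$ with parameter $\zeta$, $$K_n(x;\zeta)=\sum_{k=0}^{n}\frac{\mathfrak{p}_k(\zeta)}{\mathcal{L}_\omega[\mathfrak{p}_k^2]}\,\mathfrak{p}_k(x).$$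
   Context: $(a,b)$ is an interval (possibly unbounded) of the real line. $\omega(y)$ is a non-negative integrable function on $(a,b)$ with $\int_a^b\omega(y)\,dy=1$, all of whose moments $\int_a^b y^k\omega(y)\,dy$ are finite (absolutely convergent). For a weight function $w$ on $(a,b)$, $\mathcal{L}_w$ denotes the linear functional $\mathcal{L}_w[f]=\int_a^b f(y)w(y)\,dy$; thus $\mathcal{L}_{(y-\zeta)\omega}[f]=\int_a^b f(y)(y-\zeta)\omega(y)\,dy$. A sequence of polynomials $(P_n)_{n\ge0}$ is an orthogonal polynomial sequence (OPS) with respect to (or for) $\mathcal{L}_w$ if (1) $P_n$ is a polynomial of degree $n$ for every $n$, and (2) $\mathcal{L}_w[P_nP_m]=h_n\delta_{n,m}$ for $n,m=0,1,\ldots$, where $h_n\neq0$ for all $n$ and $\delta_{n,m}$ is Kronecker's delta. $(\mathfrak{p}_n)_{n\ge0}$ denotes the sequence of orthonormal polynomials with respect to $\mathcal{L}_\omega$ ($\mathfrak{p}_n$ of degree $n$, $\mathcal{L}_\omega[\mathfrak{p}_n\mathfrak{p}_m]=\delta_{n,m}$), where $\mathfrak{p}_n(\zeta)\neq0$ for all $n$. $P_n[\,\cdot\,]$ denotes evaluation of the polynomial $P_n$. *)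

theory Defs
  imports "HOL-Analysis.Analysis" "HOL-Computational_Algebra.Polynomial"
begin

definition weight_functional ::
  "ereal \<Rightarrow> ereal \<Rightarrow> (real \<Rightarrow> real) \<Rightarrow> (real \<Rightarrow> real) \<Rightarrow> real" where
  "weight_functional a b w f = (LINT y:einterval a b|lebesgue. f y * w y)"

text \<open>The library gives the zero polynomial degree 0; it is excluded as a zeroth member
  below because the diagonal value for \<open>n = 0\<close> is required to be nonzero.\<close>

definition is_OPS :: "((real \<Rightarrow> real) \<Rightarrow> real) \<Rightarrow> (nat \<Rightarrow> real poly) \<Rightarrow> bool" where
  "is_OPS L P \<longleftrightarrow>
     (\<forall>n. degree (P n) = n) \<and>
     (\<exists>h. (\<forall>n. h n \<noteq> 0) \<and>
        (\<forall>n m. L (\<lambda>y. poly (P n) y * poly (P m) y) = (if n = m then h n else 0)))"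

definition is_orthonormal :: "((real \<Rightarrow> real) \<Rightarrow> real) \<Rightarrow> (nat \<Rightarrow> real poly) \<Rightarrow> bool" where
  "is_orthonormal L p \<longleftrightarrow>
     (\<forall>n. degree (p n) = n) \<and>
     (\<forall>n m. L (\<lambda>y. poly (p n) y * poly (p m) y) = (if n = m then 1 else 0))"

definition kernel_poly ::
  "((real \<Rightarrow> real) \<Rightarrow> real) \<Rightarrow> (nat \<Rightarrow> real poly) \<Rightarrow> real \<Rightarrow> nat \<Rightarrow> real poly" where
  "kernel_poly L p \<zeta> n =
     (\<Sum>k\<le>n. smult (poly (p k) \<zeta> / L (\<lambda>y. (poly (p k) y)\<^sup>2)) (p k))"

end

theory Submission
  imports Defs
begin

text \<open>The kernel polynomial \<open>K\<^sub>n\<close> represents evaluation at \<open>\<zeta>\<close> on polynomials of degree at most \<open>n\<close>: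
  \<open>L[K\<^sub>n q] = q(\<zeta>)\<close>. Since \<open>q(y) = P\<^sub>n[(y - \<zeta>)(\<tau> + \<sigma> x) + x]\<close> has degree at most \<open>n\<close> in \<open>y\<close> and
  \<open>q(\<zeta>) = P\<^sub>n(x)\<close>, the integral equation for \<open>K\<^sub>n\<close> is an instance of this property.
  Conversely, orthogonality with respect to \<open>(y - \<zeta>)\<omega>\<close> says that \<open>L[P\<^sub>n q]\<close> vanishes whenever
  \<open>q(\<zeta>) = 0\<close> and \<open>deg q \<le> n\<close>, so that \<open>L[P\<^sub>n q] = q(\<zeta>) L[P\<^sub>n]\<close> and \<open>P\<^sub>n = L[P\<^sub>n] K\<^sub>n\<close>; the integral
  equation then forces \<open>L[P\<^sub>n] = 1\<close>.\<close>

section \<open>Expansion in graded and orthonormal sequences\<close>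

text \<open>Subtracting the multiple of \<open>p (Suc n)\<close> that cancels the leading
  coefficient lowers the degree bound. Stated without orthogonality, so that it serves both
  \<open>p\<close> and the unknown sequence \<open>P\<close>.\<close>

lemma graded_poly_expansion_exists:
  fixes p :: "nat \<Rightarrow> 'a::field poly"
  assumes degree_p: "\<And>k. degree (p k) = k" and p_nonzero: "\<And>k. p k \<noteq> 0" and "degree q \<le> n"
  shows "\<exists>c. q = (\<Sum>k\<le>n. smult (c k) (p k))"
  using assms(3)
proof (induction n arbitrary: q)
  case 0
  then obtain d where "q = [:d:]" by (auto elim: degree_eq_zeroE)
  moreover obtain e where e: "p 0 = [:e:]" using degree_p[of 0] by (auto elim: degree_eq_zeroE)
  moreover have "e \<noteq> 0" using e p_nonzero[of 0] by auto
  ultimately show ?case by (intro exI[of _ "\<lambda>_. d / e"]) simp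
next
  case (Suc n)
  define d where "d = coeff q (Suc n) / coeff (p (Suc n)) (Suc n)"
  have "coeff (p (Suc n)) (Suc n) \<noteq> 0"
    using p_nonzero[of "Suc n"] leading_coeff_0_iff[of "p (Suc n)"] degree_p by simp
  then have "coeff (q - smult d (p (Suc n))) (Suc n) = 0"
    by (simp add: d_def)
  moreover have "degree (q - smult d (p (Suc n))) \<le> Suc n"
    using Suc.prems by (intro degree_diff_le) (auto simp: degree_p intro: order_trans[OF degree_smult_le])
  ultimately have "degree (q - smult d (p (Suc n))) \<le> n"
    by (metis degree_0 le_SucE le0 leading_coeff_0_iff)
  then obtain c where "q - smult d (p (Suc n)) = (\<Sum>k\<le>n. smult (c k) (p k))"
    using Suc.IH by blast
  then have "q = (\<Sum>k\<le>n. smult (c k) (p k)) + smult d (p (Suc n))"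
    by (simp add: algebra_simps)
  then have "q = (\<Sum>k\<le>Suc n. smult ((c(Suc n := d)) k) (p k))"
    by simp
  then show ?case by blast
qed

text \<open>\<open>L\<close> acts on polynomials rather than on functions: once the locale is
  instantiated by the integral, integrability no longer arises and the argument is pure
  algebra.\<close>

locale orthonormal_polys =
  fixes L :: "'a::field_char_0 poly \<Rightarrow> 'a" and p :: "nat \<Rightarrow> 'a poly"
  assumes L_add: "L (q + r) = L q + L r"
    and L_smult: "L (smult c q) = c * L q"
    and degree_p [simp]: "degree (p n) = n"
    and L_p_p: "L (p n * p m) = (if n = m then 1 else 0)"
begin

lemma L_0 [simp]: "L 0 = 0"
  using L_smult[of 0 0] by simp

lemma L_diff: "L (q - r) = L q - L r"
  using L_add[of q "smult (-1) r"] L_smult[of "-1" r] by simp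

lemma L_sum: "L (sum f A) = (\<Sum>x\<in>A. L (f x))"
  by (induction A rule: infinite_finite_induct) (auto simp: L_add)

lemma p_nonzero [simp]: "p n \<noteq> 0"
  using L_p_p[of n n] by auto

lemma L_sum_smult_p:
  "L ((\<Sum>k\<le>n. smult (c k) (p k)) * p m) = (if m \<le> n then c m else 0)"
proof -
  have "L ((\<Sum>k\<le>n. smult (c k) (p k)) * p m) = (\<Sum>k\<le>n. c k * L (p k * p m))"
    by (simp add: sum_distrib_right L_sum L_smult)
  also have "\<dots> = (\<Sum>k\<le>n. if k = m then c k else 0)"
    by (intro sum.cong) (auto simp: L_p_p)
  finally show ?thesis by simp
qed

lemma expansion:
  assumes "degree q \<le> n"
  shows "q = (\<Sum>k\<le>n. smult (L (q * p k)) (p k))"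
proof -
  obtain c where c: "q = (\<Sum>k\<le>n. smult (c k) (p k))"
    using graded_poly_expansion_exists[OF degree_p p_nonzero assms] by blast
  have "L (q * p k) = c k" if "k \<le> n" for k
    using that by (simp add: c L_sum_smult_p)
  then have "(\<Sum>k\<le>n. smult (L (q * p k)) (p k)) = (\<Sum>k\<le>n. smult (c k) (p k))"
    by (intro sum.cong) auto
  then show ?thesis using c by simp
qed

lemma L_nondegenerate:
  assumes "degree d \<le> n" and "\<And>q. degree q \<le> n \<Longrightarrow> L (d * q) = 0"
  shows "d = 0"
  using expansion[OF assms(1)] assms(2) by simp

section \<open>Kernel polynomials and their reproducing property\<close>

text \<open>This is \<open>kernel_poly\<close> with the denominators dropped, as they equal 1 for an
  orthonormal sequence.\<close>

definition K :: "'a \<Rightarrow> nat \<Rightarrow> 'a poly" where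
  "K z n = (\<Sum>k\<le>n. smult (poly (p k) z) (p k))"

lemma degree_K_le: "degree (K z n) \<le> n"
  unfolding K_def by (intro degree_sum_le) (auto intro: order_trans[OF degree_smult_le])

text \<open>Pairing with \<open>K z n\<close> weights each Fourier coefficient of \<open>q\<close>
  by \<open>poly (p k) z\<close>, and the expansion of \<open>q\<close> resums these to its value at
  \<open>z\<close>.\<close>

lemma L_K:
  assumes "degree q \<le> n"
  shows "L (K z n * q) = poly q z"
proof -
  have "L (K z n * q) = (\<Sum>k\<le>n. poly (p k) z * L (q * p k))"
    by (simp add: K_def sum_distrib_right L_sum L_smult mult.commute[of q])
  also have "\<dots> = poly (\<Sum>k\<le>n. smult (L (q * p k)) (p k)) z"
    by (simp add: poly_sum mult.commute)
  finally show ?thesis using expansion[OF assms] by simp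
qed

lemma degree_K:
  assumes "poly (p n) z \<noteq> 0"
  shows "degree (K z n) = n"
proof (rule antisym[OF degree_K_le])
  have "coeff (p k) n = 0" if "k < n" for k
    using that by (simp add: coeff_eq_0)
  then have "coeff (K z n) n = poly (p n) z * coeff (p n) n"
    by (simp add: K_def coeff_sum lessThan_Suc_atMost[symmetric])
  also have "\<dots> \<noteq> 0"
    using assms p_nonzero[of n] leading_coeff_0_iff[of "p n"] by simp
  finally show "n \<le> degree (K z n)" by (rule le_degree)
qed

text \<open>The product of the linear factor and \<open>K z m\<close> has degree at most
  \<open>m + 1\<close>, hence at most \<open>n\<close>, and vanishes at \<open>z\<close>; the
  reproducing property of \<open>K z n\<close> applies.\<close>

lemma L_linear_K_K_less:
  assumes "m < n"
  shows "L ([:-z, 1:] * (K z n * K z m)) = 0"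
proof -
  have "degree ([:-z, 1:] * K z m) \<le> n"
    using degree_mult_le[of "[:-z, 1:]" "K z m"] degree_K_le[of z m] assms by simp
  from L_K[OF this, of z] show ?thesis by (simp add: mult.left_commute)
qed

text \<open>Otherwise \<open>q\<close>, of degree \<open>n + 1\<close>, would be orthogonal to
  \<open>K z 0\<close>, ..., \<open>K z (n + 1)\<close>, hence to \<open>p 0\<close>, ...,
  \<open>p (n + 1)\<close>, and would be zero.\<close>

lemma L_linear_K_K_same:
  assumes nz: "\<And>k. poly (p k) z \<noteq> 0"
  shows "L ([:-z, 1:] * (K z n * K z n)) \<noteq> 0"
proof
  assume 0: "L ([:-z, 1:] * (K z n * K z n)) = 0"
  define q where "q = [:-z, 1:] * K z n"
  have "K z n \<noteq> 0"
    using L_K[of 1 n z] by auto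
  then have degq: "degree q = Suc n"
    by (simp add: q_def degree_mult_eq degree_K[OF nz] del: mult_pCons_left)
  have q_K: "L (q * K z k) = 0" if k: "k \<le> Suc n" for k
  proof -
    consider "k < n" | "k = n" | "k = Suc n" using k by linarith
    then show ?thesis
    proof cases
      case 1
      then show ?thesis
        using L_linear_K_K_less[of k n z] by (simp add: q_def mult.assoc del: mult_pCons_left)
    next
      case 2
      then show ?thesis using 0 by (simp add: q_def mult.assoc del: mult_pCons_left)
    next
      case 3
      then show ?thesis using L_K[of q "Suc n" z] degq by (simp add: mult.commute q_def)
    qed
  qed
  \<comment> \<open>Consecutive kernels differ by \<open>poly (p k) z\<close> times
    \<open>p k\<close>, and this factor is nonzero.\<close>
  have q_p: "L (q * p k) = 0" if "k \<le> Suc n" for k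
  proof (cases k)
    case 0
    have "poly (p 0) z * L (q * p 0) = L (q * K z 0)"
      by (simp add: K_def L_smult)
    then show ?thesis using q_K[of 0] nz 0 by simp
  next
    case (Suc j)
    have "poly (p k) z * L (q * p k) = L (q * K z k) - L (q * K z j)"
      by (simp add: K_def Suc distrib_left L_add L_smult)
    then show ?thesis using q_K[of k] q_K[of j] nz that Suc by simp
  qed
  have "q = 0"
    using expansion[of q "Suc n"] degq q_p by simp
  then show False using degq by simp
qed

text \<open>Dividing a test polynomial \<open>q\<close> by the linear factor leaves the remainder
  \<open>poly q z\<close>, so both sides pair with \<open>q\<close> to
  \<open>poly q z * L Q\<close>; nondegeneracy makes them equal.\<close>

lemma eq_smult_K:
  assumes "degree Q \<le> n" and orth: "\<And>r. degree r < n \<Longrightarrow> L ([:-z, 1:] * (Q * r)) = 0"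
  shows "Q = smult (L Q) (K z n)"
proof -
  have "Q - smult (L Q) (K z n) = 0"
  proof (rule L_nondegenerate)
    show "degree (Q - smult (L Q) (K z n)) \<le> n"
      using assms(1) degree_K_le by (intro degree_diff_le) (auto intro: order_trans[OF degree_smult_le])
  next
    fix q :: "'a poly" assume q: "degree q \<le> n"
    define r where "r = synthetic_div q z"
    \<comment> \<open>For \<open>n = 0\<close> no degree lies below \<open>n\<close>, so
      \<open>orth\<close> is vacuous; there \<open>q\<close> is constant and the quotient
      \<open>r\<close> is zero.\<close>
    have "L ([:-z, 1:] * (Q * r)) = 0"
    proof (cases "n = 0")
      case True
      then have "r = 0" using q by (simp add: r_def synthetic_div_eq_0_iff)
      then show ?thesis by simp
    next
      case False
      then have "degree r < n" using q by (simp add: r_def degree_synthetic_div)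
      then show ?thesis by (rule orth)
    qed
    moreover have "Q * q = [:-z, 1:] * (Q * r) + smult (poly q z) Q"
    proof -
      have "Q * q = Q * ([:-z, 1:] * r + [:poly q z:])"
        unfolding r_def synthetic_div_correct' ..
      then show ?thesis by (simp add: distrib_left mult.left_commute del: mult_pCons_left)
    qed
    ultimately have "L (Q * q) = poly q z * L Q" by (simp add: L_add L_smult del: mult_pCons_left)
    then show "L ((Q - smult (L Q) (K z n)) * q) = 0"
      using L_K[OF q, of z] by (simp add: left_diff_distrib L_diff L_smult)
  qed
  then show ?thesis by simp
qed

lemma kernel_characterisation:
  assumes nz: "\<And>k. poly (p k) z \<noteq> 0"
  shows "((\<forall>n. degree (P n) = n) \<and>
          (\<exists>h. (\<forall>n. h n \<noteq> 0) \<and>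
             (\<forall>n m. L ([:-z, 1:] * (P n * P m)) = (if n = m then h n else 0))) \<and>
          (\<forall>n x. L (P n * pcompose (P n) ([:-z, 1:] * [:\<tau> + \<sigma> * x:] + [:x:])) = poly (P n) x))
     \<longleftrightarrow> (\<forall>n. P n = K z n)" (is "?ops \<longleftrightarrow> _")
proof
  let ?A = "\<lambda>x. [:-z, 1:] * [:\<tau> + \<sigma> * x:] + [:x:]"
  \<comment> \<open>For fixed \<open>x\<close>, \<open>?A x\<close> is a polynomial in y of degree
    at most 1 with value \<open>x\<close> at \<open>z\<close>. Composing with it keeps the degree
    bound that \<open>L_K\<close> needs and gives the value \<open>poly Q x\<close> at
    \<open>z\<close>.\<close>
  have degA: "degree (pcompose Q (?A x)) \<le> degree Q" for Q x
  proof -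
    have "degree (?A x) \<le> 1" by (simp add: degree_pCons_le)
    then show ?thesis using mult_le_mono2[of "degree (?A x)" 1 "degree Q"] by (simp add: degree_pcompose)
  qed
  have polyA: "poly (pcompose Q (?A x)) z = poly Q x" for Q x
    by (simp add: poly_pcompose)
  {
    assume ?ops
    then obtain h where deg: "\<And>n. degree (P n) = n" and h: "\<And>n. h n \<noteq> 0"
      and orth: "\<And>n m. L ([:-z, 1:] * (P n * P m)) = (if n = m then h n else 0)"
      and eq: "\<And>n x. L (P n * pcompose (P n) (?A x)) = poly (P n) x" by blast
    have P_nonzero: "P n \<noteq> 0" for n
      using orth[of n n] h[of n] by auto
    show "\<forall>n. P n = K z n"
    proof
      fix n
      have PK: "P n = smult (L (P n)) (K z n)"
      proof (rule eq_smult_K)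
        \<comment> \<open>Orthogonality is known only among the \<open>P k\<close>; since
          \<open>P\<close> is graded, \<open>r\<close> is a combination of those with
          \<open>k < n\<close>.\<close>
        fix r :: "'a poly" assume "degree r < n"
        then obtain c where c: "r = (\<Sum>k\<le>degree r. smult (c k) (P k))"
          using graded_poly_expansion_exists[OF deg P_nonzero, of r "degree r"] by blast
        have "L ([:-z, 1:] * (P n * (\<Sum>k\<le>degree r. smult (c k) (P k))))
            = (\<Sum>k\<le>degree r. c k * L ([:-z, 1:] * (P n * P k)))"
          by (simp add: sum_distrib_left L_sum L_smult del: mult_pCons_left)
        also have "\<dots> = 0"
          using \<open>degree r < n\<close> by (intro sum.neutral) (auto simp: orth simp del: mult_pCons_left)
        finally show "L ([:-z, 1:] * (P n * r)) = 0" using c by simp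
      qed (simp add: deg)
      have "poly (P n) x = L (P n) * poly (P n) x" for x
      proof -
        have "poly (P n) x = L (P n * pcompose (P n) (?A x))" by (simp only: eq)
        also have "\<dots> = L (P n) * L (K z n * pcompose (P n) (?A x))"
          \<comment> \<open>Only the outer factor is replaced by its kernel form; the composed
            factor stays as the test polynomial for \<open>L_K\<close>.\<close>
          by (subst (1) PK) (simp only: mult_smult_left L_smult)
        also have "\<dots> = L (P n) * poly (P n) x"
          using degA[of "P n" x] deg by (simp only: L_K polyA)
        finally show ?thesis .
      qed
      then have "poly (smult (L (P n) - 1) (P n)) x = 0" for x
        by (simp add: algebra_simps)
      then have "smult (L (P n) - 1) (P n) = 0"
        using poly_all_0_iff_0 by blast
      then have "L (P n) = 1"
        using P_nonzero[of n] by simp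
      then show "P n = K z n" using PK by simp
    qed
  next
    assume "\<forall>n. P n = K z n"
    then have P: "P = K z" by auto
    have "L ([:-z, 1:] * (K z n * K z m)) = (if n = m then L ([:-z, 1:] * (K z n * K z n)) else 0)" for n m
      using L_linear_K_K_less[of n m z] L_linear_K_K_less[of m n z]
      by (cases n m rule: linorder_cases) (simp_all add: mult.commute del: mult_pCons_left)
    moreover have "L (K z n * pcompose (K z n) (?A x)) = poly (K z n) x" for n x
      using L_K[of "pcompose (K z n) (?A x)" n z] order_trans[OF degA degree_K_le] by (simp only: polyA)
    ultimately show ?ops
      unfolding P using L_linear_K_K_same[OF nz] degree_K[OF nz]
      by (intro conjI exI[of _ "\<lambda>n. L ([:-z, 1:] * (K z n * K z n))"] allI) assumption+
  }
qed

end

section \<open>From the integral to the algebraic functional\<close>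

text \<open>Additivity of the integral requires integrability of both summands; finite moments give
  it for every polynomial, monomial by monomial.\<close>

lemma weight_functional_poly_linear:
  fixes q r :: "real poly"
  assumes int: "\<And>k::nat. set_integrable lebesgue (einterval a b) (\<lambda>y. y ^ k * w y)"
  shows "weight_functional a b w (poly (q + r)) = weight_functional a b w (poly q) + weight_functional a b w (poly r)"
    and "weight_functional a b w (poly (smult c q)) = c * weight_functional a b w (poly q)"
proof -
  have i: "set_integrable lebesgue (einterval a b) (\<lambda>y. poly q y * w y)" for q :: "real poly"
  proof -
    have "set_integrable lebesgue (einterval a b) (\<lambda>y. \<Sum>k\<le>degree q. coeff q k * (y ^ k * w y))"
      using int unfolding set_integrable_def scaleR_sum_right
      by (intro Bochner_Integration.integrable_sum) (simp add: mult.left_commute)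
    then show ?thesis by (simp add: poly_altdef sum_distrib_right mult.assoc)
  qed
  show "weight_functional a b w (poly (q + r)) = weight_functional a b w (poly q) + weight_functional a b w (poly r)"
    using set_integral_add(2)[OF i i] by (simp add: weight_functional_def distrib_right)
  show "weight_functional a b w (poly (smult c q)) = c * weight_functional a b w (poly q)"
    by (simp add: weight_functional_def mult.assoc)
qed

theorem corollary6:
  fixes a b :: ereal and \<omega> :: "real \<Rightarrow> real" and \<zeta> \<tau> \<sigma> :: real
    and p P :: "nat \<Rightarrow> real poly"
  assumes "a < b"
    and "\<And>y. y \<in> einterval a b \<Longrightarrow> \<omega> y \<ge> 0"
    and "set_integrable lebesgue (einterval a b) \<omega>"
    and "(LINT y:einterval a b|lebesgue. \<omega> y) = 1"
    and "\<And>k::nat. set_integrable lebesgue (einterval a b) (\<lambda>y. y ^ k * \<omega> y)"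
    and "\<zeta> \<notin> einterval a b"
    and "is_orthonormal (weight_functional a b \<omega>) p"
    and "\<And>n. poly (p n) \<zeta> \<noteq> 0"
  shows "(is_OPS (weight_functional a b (\<lambda>y. (y - \<zeta>) * \<omega> y)) P \<and>
          (\<forall>n x. (LINT y:einterval a b|lebesgue.
                    poly (P n) y * poly (P n) ((y - \<zeta>) * (\<tau> + \<sigma> * x) + x) * \<omega> y)
                 = poly (P n) x))
     \<longleftrightarrow> (\<forall>n. P n = kernel_poly (weight_functional a b \<omega>) p \<zeta> n)"
proof -
  define L where "L q = weight_functional a b \<omega> (poly q)" for q
  have L_unfold: "L q = (LINT y:einterval a b|lebesgue. poly q y * \<omega> y)" for q
    by (simp add: L_def weight_functional_def)
  have orth: "degree (p n) = n" "L (p n * p m) = (if n = m then 1 else 0)" for n m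
    using assms(7) by (simp_all add: is_orthonormal_def L_def poly_mult[abs_def])
  interpret orthonormal_polys L p
    using weight_functional_poly_linear[OF assms(5)] by unfold_locales (auto simp: L_def orth[unfolded L_def])
  have kernel: "kernel_poly (weight_functional a b \<omega>) p \<zeta> n = K \<zeta> n" for n
  proof -
    have "weight_functional a b \<omega> (\<lambda>y. (poly (p k) y)\<^sup>2) = 1" for k
      using orth(2)[of k k] by (simp add: L_def power2_eq_square poly_mult[abs_def])
    then show ?thesis by (simp add: kernel_poly_def K_def)
  qed
  \<comment> \<open>The factor \<open>y - \<zeta>\<close> moves from the weight into the polynomial,
    so both orthogonality relations are statements about the same \<open>L\<close>.\<close>
  have ops: "weight_functional a b (\<lambda>y. (y - \<zeta>) * \<omega> y) (\<lambda>y. poly (P n) y * poly (P m) y)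
      = L ([:-\<zeta>, 1:] * (P n * P m))" for n m
    unfolding L_unfold weight_functional_def
    by (intro arg_cong[where f = "set_lebesgue_integral lebesgue (einterval a b)"] ext) (simp add: algebra_simps)
  have eq: "(LINT y:einterval a b|lebesgue.
        poly (P n) y * poly (P n) ((y - \<zeta>) * (\<tau> + \<sigma> * x) + x) * \<omega> y)
      = L (P n * pcompose (P n) ([:-\<zeta>, 1:] * [:\<tau> + \<sigma> * x:] + [:x:]))" for n x
  proof -
    have "poly ([:-\<zeta>, 1:] * [:\<tau> + \<sigma> * x:] + [:x:]) y = (y - \<zeta>) * (\<tau> + \<sigma> * x) + x" for y
      by (simp add: algebra_simps)
    then show ?thesis unfolding L_unfold by (simp only: poly_mult poly_pcompose)
  qed
  show ?thesis
    unfolding is_OPS_def ops eq kernel conj_assoc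
    by (rule kernel_characterisation[OF assms(8)])
qed

end
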